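(* Fix $\tau>0$ and a compact set $\mathcal K\subset\mathbb R^{n+1}$ containing the inner iterates. Suppose the component gradients $\nabla f_i$ are continuous on the projection of $\mathcal K$ to $\mathbb R^n$, every stored pair $(s_j,\widetilde y_j)$ obeys $$\frac{s_j^T\widetilde y_j}{\|s_j\|^2}>m_{\rm cur},\qquad \frac{\|\widetilde y_j\|^2}{s_j^T\widetilde y_j}<M_{\rm cur},$$ and the number $q$ of stored pairs satisfies $q\le m_L$. Then there are constants $0<\underline h_\tau\le\overline h_\tau<\infty$, independent of the inner iteration, such that at every inner iterate $$\underline h_\tau I\preceq H_{\mathcal M,P}\preceq\overline h_\tau I.$$ In particular, the L-BFGS direction $d=-H_{\mathcal M,P}\,g$, $g=\nabla\Phi_\tau(z)$, is a strict descent direction (that is, $g^Td<0$) whenever $g\ne0$.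
   Context: Let $f_1,\dots,f_m:\mathbb R^n\to\mathbb R$ be differentiable. For $\tau>0$ put $\phi_\tau(r)=\frac{r+\sqrt{r^2+\tau^2}}{2}$ and $\Phi_\tau(x,t)=t+\sum_{i=1}^m\phi_\tau(f_i(x)-t)$, $(x,t)\in\mathbb R^n\times\mathbb R$. Preconditioner. For $z=(x,t)$ put $q_i(x)=(\nabla f_i(x)^T,-1)^T$, $\omega_i=((f_i(x)-t)^2+\tau^2)^{1/2}$, let $J(z)\in\mathbb R^{m\times(n+1)}$ have rows $q_i(x)^T$, $\Pi_x=\begin{pmatrix}I_n&0\\0&0\end{pmatrix}$, $D^{\rm hyp}(z,\tau)=\operatorname{diag}(\omega_1^{-1},\dots,\omega_m^{-1})$, and $$P(z,\tau)=\delta I_{n+1}+\bar L\,\Pi_x+\tfrac12J(z)^TD^{\rm hyp}(z,\tau)J(z),$$ where $\delta>0$ and $\bar L=\sum_iL_i$ are fixed, $L_i\ge0$ being a Lipschitz constant of $\nabla f_i$ on a set containing the accepted iterates and every line-search trial segment. Limited-memory metric. Fixed parameters: memory capacity $m_L\ge1$, $0<m_{\rm cur}<M_{\rm cur}$, $\chi_0>0$, $0<\chi_{\min}\le\chi_{\max}$. At an inner iterate $z$, with $P=P(z,\tau)$ and an ordered memory $\mathcal M=\{(s_j,\widetilde y_j,\rho_j)\}_{j=1}^q$, $q\le m_L$, $s_j\neq0$, $\rho_j=(s_j^T\widetilde y_j)^{-1}$, the inverse metric $H_{\mathcal M,P}$ is defined as $H^{(q)}$, where $$H^{(0)}=\chi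 P^{-1},\qquad \chi=\chi_0\ \text{if }q=0,\qquad \chi=\min\Bigl\{\chi_{\max},\max\Bigl\{\chi_{\min},\frac{s_q^T\widetilde y_q}{\widetilde y_q^TP^{-1}\widetilde y_q}\Bigr\}\Bigr\}\ \text{if }q>0,$$ $$H^{(j)}=(I-\rho_js_j\widetilde y_j^T)H^{(j-1)}(I-\rho_j\widetilde y_js_j^T)+\rho_js_js_j^T,\qquad j=1,\dots,q.$$ "Independent of the inner iteration" means the constants do not depend on which iterate in $\mathcal K$ and which admissible memory are used. $A\preceq B$ means $B-A$ is positive semidefinite; norms are Euclidean. *)

theory Defs
  imports "HOL-Analysis.Analysis"
begin

(* A point z = (x,t) of R^n x R is a vector indexed by 'n option: the coordinates Some j
   carry x, the coordinate None carries t. *)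

definition xpart :: "real ^ ('n::finite option) \<Rightarrow> real ^ 'n" where
  "xpart z = (\<chi> j. z $ Some j)"

definition tpart :: "real ^ ('n::finite option) \<Rightarrow> real" where
  "tpart z = z $ None"

(* Only meaningful where f is differentiable; the gradient is then unique. *)
definition gradient :: "('a::real_inner \<Rightarrow> real) \<Rightarrow> 'a \<Rightarrow> 'a" where
  "gradient f x = (THE D. GDERIV f x :> D)"

definition phi :: "real \<Rightarrow> real \<Rightarrow> real" where
  "phi \<tau> r = (r + sqrt (r\<^sup>2 + \<tau>\<^sup>2)) / 2"

definition Phi :: "('m::finite \<Rightarrow> real ^ 'n \<Rightarrow> real) \<Rightarrow> real \<Rightarrow> real ^ ('n::finite option) \<Rightarrow> real" where
  "Phi f \<tau> z = tpart z + (\<Sum>i\<in>UNIV. phi \<tau> (f i (xpart z) - tpart z))"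

definition qvec :: "(real ^ 'n \<Rightarrow> real) \<Rightarrow> real ^ 'n \<Rightarrow> real ^ ('n::finite option)" where
  "qvec f x = (\<chi> k. case k of Some j \<Rightarrow> gradient f x $ j | None \<Rightarrow> - 1)"

definition omega :: "(real ^ 'n \<Rightarrow> real) \<Rightarrow> real \<Rightarrow> real ^ ('n::finite option) \<Rightarrow> real" where
  "omega f \<tau> z = sqrt ((f (xpart z) - tpart z)\<^sup>2 + \<tau>\<^sup>2)"

definition Jmat :: "('m \<Rightarrow> real ^ 'n \<Rightarrow> real) \<Rightarrow> real ^ ('n::finite option) \<Rightarrow> real ^ ('n option) ^ 'm" where
  "Jmat f z = (\<chi> i. qvec (f i) (xpart z))"

definition Pi_x :: "real ^ ('n::finite option) ^ ('n option)" where
  "Pi_x = (\<chi> k l. if k = l \<and> k \<noteq> None then 1 else 0)"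

definition Dhyp :: "('m \<Rightarrow> real ^ 'n \<Rightarrow> real) \<Rightarrow> real \<Rightarrow> real ^ ('n::finite option) \<Rightarrow> real ^ 'm ^ 'm" where
  "Dhyp f \<tau> z = (\<chi> i k. if i = k then inverse (omega (f i) \<tau> z) else 0)"

definition precond ::
  "real \<Rightarrow> real \<Rightarrow> ('m::finite \<Rightarrow> real ^ 'n \<Rightarrow> real) \<Rightarrow> real \<Rightarrow> real ^ ('n::finite option) \<Rightarrow>
    real ^ ('n::finite option) ^ ('n option)" where
  "precond \<delta> Lbar f \<tau> z =
     \<delta> *\<^sub>R mat 1 + Lbar *\<^sub>R Pi_x
       + (1/2) *\<^sub>R (transpose (Jmat f z) ** Dhyp f \<tau> z ** Jmat f z)"

definition outer :: "real ^ 'k \<Rightarrow> real ^ 'k \<Rightarrow> real ^ 'k ^ 'k" where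
  "outer u v = (\<chi> i j. u $ i * v $ j)"

(* A memory is the list [(s_1,y_1),...,(s_q,y_q)], oldest pair first; the stored scalar
   rho_j is a function of its pair and is recomputed in bfgs_update. *)

definition admissible_memory ::
  "nat \<Rightarrow> real \<Rightarrow> real \<Rightarrow> ((real ^ 'k) \<times> (real ^ 'k)) list \<Rightarrow> bool" where
  "admissible_memory mL mcur Mcur mem \<longleftrightarrow>
     length mem \<le> mL \<and>
     (\<forall>(s, y) \<in> set mem. s \<noteq> 0 \<and> (s \<bullet> y) / (norm s)\<^sup>2 > mcur \<and> (norm y)\<^sup>2 / (s \<bullet> y) < Mcur)"

definition chi_scale ::
  "real \<Rightarrow> real \<Rightarrow> real \<Rightarrow> ((real ^ 'k) \<times> (real ^ 'k)) list \<Rightarrow> real ^ 'k ^ 'k \<Rightarrow> real" where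
  "chi_scale \<chi>0 \<chi>min \<chi>max mem P =
     (if mem = [] then \<chi>0
      else (let (s, y) = last mem
            in min \<chi>max (max \<chi>min ((s \<bullet> y) / (y \<bullet> (matrix_inv P *v y))))))"

definition bfgs_update ::
  "real ^ 'k ^ 'k \<Rightarrow> (real ^ 'k) \<times> (real ^ 'k) \<Rightarrow> real ^ 'k ^ 'k" where
  "bfgs_update H p =
     (let (s, y) = p; \<rho> = inverse (s \<bullet> y)
      in (mat 1 - \<rho> *\<^sub>R outer s y) ** H ** (mat 1 - \<rho> *\<^sub>R outer y s) + \<rho> *\<^sub>R outer s s)"

definition lbfgs_metric ::
  "real \<Rightarrow> real \<Rightarrow> real \<Rightarrow> ((real ^ 'k) \<times> (real ^ 'k)) list \<Rightarrow> real ^ 'k ^ 'k \<Rightarrow> real ^ 'k ^ 'k" where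
  "lbfgs_metric \<chi>0 \<chi>min \<chi>max mem P =
     foldl bfgs_update (chi_scale \<chi>0 \<chi>min \<chi>max mem P *\<^sub>R matrix_inv P) mem"

definition psd :: "real ^ 'k ^ 'k \<Rightarrow> bool" where
  "psd A \<longleftrightarrow> transpose A = A \<and> (\<forall>v. 0 \<le> v \<bullet> (A *v v))"

definition psd_le :: "real ^ 'k ^ 'k \<Rightarrow> real ^ 'k ^ 'k \<Rightarrow> bool" (infix "\<preceq>" 50) where
  "A \<preceq> B \<longleftrightarrow> psd (B - A)"

end

theory Submission
  imports Defs
begin

(* All bounds are bounds on quadratic forms. On K the vectors q_i are bounded and omega_i \<ge> \<tau>, so
   \<delta> I \<preceq> P \<preceq> p I with p independent of z, hence I/p \<preceq> inverse P \<preceq> I/\<delta>. For one BFGS update put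
   w = v - \<rho> (s . v) y. Then v . H' v = w . H w + \<rho> (s . v)^2, where \<rho> |s|^2 < 1/mcur and \<rho> |y|^2 < Mcur;
   bounding |w| by |v| gives the new upper bound and bounding |v| by |w| and \<rho> (s . v)^2 the new lower
   bound. At most mL updates are made, so the constants stay uniform. *)

section \<open>Symmetric matrices between two multiples of the identity\<close>

lemma transpose_diff: "transpose (A - B) = transpose A - transpose (B :: real ^ 'n ^ 'm)"
  by (simp add: transpose_def vec_eq_iff)

lemma transpose_add: "transpose (A + B) = transpose A + transpose (B :: real ^ 'n ^ 'm)"
  by (simp add: transpose_def vec_eq_iff)

lemma inner_matrix_vector_symmetric:
  fixes A :: "real ^ 'k::finite ^ 'k"
  assumes "transpose A = A"
  shows "u \<bullet> (A *v v) = v \<bullet> (A *v u)"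
proof -
  have "u \<bullet> (A *v v) = (transpose A *v u) \<bullet> v"
    by (simp add: dot_lmul_matrix)
  then show ?thesis
    by (simp add: assms inner_commute)
qed

lemma scaled_identity_psd_le_iff:
  fixes A :: "real ^ 'k::finite ^ 'k"
  shows "c *\<^sub>R mat 1 \<preceq> A \<longleftrightarrow> transpose A = A \<and> (\<forall>v. c * (v \<bullet> v) \<le> v \<bullet> (A *v v))"
  by (auto simp: psd_le_def psd_def transpose_diff transpose_scalar transpose_mat
      matrix_vector_mult_diff_rdistrib scaleR_matrix_vector_assoc[symmetric] inner_diff_right)

lemma psd_le_scaled_identity_iff:
  fixes A :: "real ^ 'k::finite ^ 'k"
  shows "A \<preceq> c *\<^sub>R mat 1 \<longleftrightarrow> transpose A = A \<and> (\<forall>v. v \<bullet> (A *v v) \<le> c * (v \<bullet> v))"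
  by (auto simp: psd_le_def psd_def transpose_diff transpose_scalar transpose_mat
      matrix_vector_mult_diff_rdistrib scaleR_matrix_vector_assoc[symmetric] inner_diff_right)

text \<open>Keeps both bounds in one predicate, so that they pass together through scaling,
  inversion and updating. Symmetry travels with them, since \<open>psd\<close> demands it.\<close>

definition between_scaled_identities :: "real \<Rightarrow> real \<Rightarrow> real ^ 'k::finite ^ 'k \<Rightarrow> bool" where
  "between_scaled_identities a b A \<longleftrightarrow> a *\<^sub>R mat 1 \<preceq> A \<and> A \<preceq> b *\<^sub>R mat 1"

lemma between_scaled_identities_iff:
  "between_scaled_identities a b A \<longleftrightarrow> transpose A = A \<and>
     (\<forall>v. a * (v \<bullet> v) \<le> v \<bullet> (A *v v) \<and> v \<bullet> (A *v v) \<le> b * (v \<bullet> v))"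
  by (auto simp: between_scaled_identities_def scaled_identity_psd_le_iff psd_le_scaled_identity_iff)

lemma between_scaled_identities_mono:
  assumes "between_scaled_identities a b A" "a' \<le> a" "b \<le> b'"
  shows "between_scaled_identities a' b' A"
  unfolding between_scaled_identities_iff
proof (intro conjI allI)
  fix v
  show "a' * (v \<bullet> v) \<le> v \<bullet> (A *v v)"
    using assms mult_right_mono[of a' a "v \<bullet> v"] unfolding between_scaled_identities_iff
    by (metis inner_ge_zero order_trans)
  show "v \<bullet> (A *v v) \<le> b' * (v \<bullet> v)"
    using assms mult_right_mono[of b b' "v \<bullet> v"] unfolding between_scaled_identities_iff
    by (metis inner_ge_zero order_trans)
qed (use assms in \<open>simp add: between_scaled_identities_iff\<close>)

text \<open>The factor \<open>e\<close> is known only up to an interval because it will be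
  \<open>chi_scale\<close>, which varies with the memory and the preconditioner.\<close>

lemma between_scaled_identities_scaleR:
  assumes A: "between_scaled_identities a b A" and "0 \<le> a" "0 \<le> b" "0 \<le> c" "c \<le> e" "e \<le> d"
  shows "between_scaled_identities (c * a) (d * b) (e *\<^sub>R A)"
  unfolding between_scaled_identities_iff
proof (intro conjI allI)
  fix v
  have le: "a * (v \<bullet> v) \<le> v \<bullet> (A *v v)" "v \<bullet> (A *v v) \<le> b * (v \<bullet> v)"
    using A by (auto simp: between_scaled_identities_iff)
  have "c * (a * (v \<bullet> v)) \<le> e * (v \<bullet> (A *v v))"
    using assms le by (intro mult_mono) auto
  then show "c * a * (v \<bullet> v) \<le> v \<bullet> ((e *\<^sub>R A) *v v)"
    by (simp add: scaleR_matrix_vector_assoc[symmetric] mult.assoc)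
  have "e * (v \<bullet> (A *v v)) \<le> d * (b * (v \<bullet> v))"
    using assms le by (intro mult_mono) (auto intro: order_trans[OF _ le(1)])
  then show "v \<bullet> ((e *\<^sub>R A) *v v) \<le> d * b * (v \<bullet> v)"
    by (simp add: scaleR_matrix_vector_assoc[symmetric] mult.assoc)
qed (use A in \<open>simp add: between_scaled_identities_iff transpose_scalar\<close>)

text \<open>No eigenvalues enter. With \<open>u = matrix_inv A *v v\<close>, the lower bound comes
  from the form of \<open>A\<close> at \<open>u - (1 / b) *\<^sub>R v\<close>, the upper one from
  the squared length of \<open>v - a *\<^sub>R u\<close>. These vectors vanish when \<open>A\<close>
  is \<open>b\<close> or \<open>a\<close> times the identity, so no constant is lost.\<close>

lemma between_scaled_identities_matrix_inv:
  fixes A :: "real ^ 'k::finite ^ 'k"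
  assumes A: "between_scaled_identities a b A" and "0 < a" "0 < b"
  shows "between_scaled_identities (1 / b) (1 / a) (matrix_inv A)"
proof -
  have sym: "transpose A = A" and lo: "\<And>v. a * (v \<bullet> v) \<le> v \<bullet> (A *v v)"
    and up: "\<And>v. v \<bullet> (A *v v) \<le> b * (v \<bullet> v)"
    using A by (auto simp: between_scaled_identities_iff)
  \<comment> \<open>A positive lower bound forces a trivial kernel, which makes the square matrix
    invertible.\<close>
  have "v = 0" if "A *v v = 0" for v
  proof -
    have "a * (v \<bullet> v) \<le> 0"
      using lo[of v] that by simp
    then have "v \<bullet> v \<le> 0"
      using \<open>0 < a\<close> by (simp add: mult_le_0_iff)
    then show ?thesis
      by (metis inner_gt_zero_iff not_le)
  qed
  then obtain B where "B ** A = mat 1"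
    using matrix_left_invertible_ker by blast
  then have "invertible A"
    using invertible_left_inverse by blast
  then have inv: "A ** matrix_inv A = mat 1" "matrix_inv A ** A = mat 1"
    unfolding invertible_def matrix_inv_def by (metis (mono_tags, lifting) someI_ex)+
  \<comment> \<open>Transposing \<open>A ** matrix_inv A = mat 1\<close> shows that the transposed
    inverse is a left inverse of the symmetric \<open>A\<close>; it must then be the inverse
    itself.\<close>
  have "transpose (matrix_inv A) ** A = mat 1"
    using arg_cong[OF inv(1), of transpose] by (simp add: matrix_transpose_mul sym transpose_mat)
  then have "transpose (matrix_inv A) ** (A ** matrix_inv A) = matrix_inv A"
    by (simp add: matrix_mul_assoc)
  then have inv_sym: "transpose (matrix_inv A) = matrix_inv A"
    by (simp add: inv)
  have "1 / b * (v \<bullet> v) \<le> v \<bullet> (matrix_inv A *v v) \<and> v \<bullet> (matrix_inv A *v v) \<le> 1 / a * (v \<bullet> v)" for v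
  proof -
    define u where "u = matrix_inv A *v v"
    have v: "A *v u = v"
      by (simp add: u_def matrix_vector_mul_assoc inv)
    have nonneg: "0 \<le> x \<bullet> (A *v x)" for x
      using lo[of x] \<open>0 < a\<close> by (meson inner_ge_zero less_imp_le mult_nonneg_nonneg order_trans)
    have "u \<bullet> (A *v v) = v \<bullet> v"
      using inner_matrix_vector_symmetric[OF sym, of u v] by (simp add: v)
    then have "(u - (1 / b) *\<^sub>R v) \<bullet> (A *v (u - (1 / b) *\<^sub>R v)) =
        u \<bullet> v - 2 / b * (v \<bullet> v) + (1 / b)\<^sup>2 * (v \<bullet> (A *v v))"
      by (simp add: v matrix_vector_mult_diff_distrib matrix_vector_mult_scaleR inner_diff_left
          inner_diff_right inner_commute[of v u] power2_eq_square algebra_simps)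
    with nonneg have "0 \<le> u \<bullet> v - 2 / b * (v \<bullet> v) + (1 / b)\<^sup>2 * (v \<bullet> (A *v v))"
      by metis
    also have "\<dots> \<le> u \<bullet> v - 2 / b * (v \<bullet> v) + (1 / b)\<^sup>2 * (b * (v \<bullet> v))"
      using up[of v] by (intro add_left_mono mult_left_mono) auto
    also have "\<dots> = u \<bullet> v - 1 / b * (v \<bullet> v)"
      using \<open>0 < b\<close> by (simp add: field_simps power2_eq_square)
    finally have "1 / b * (v \<bullet> v) \<le> u \<bullet> v"
      by simp
    moreover have "u \<bullet> v \<le> 1 / a * (v \<bullet> v)"
    proof -
      have "0 \<le> (v - a *\<^sub>R u) \<bullet> (v - a *\<^sub>R u)"
        by simp
      also have "\<dots> = v \<bullet> v - 2 * a * (u \<bullet> v) + a * (a * (u \<bullet> u))"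
        by (simp add: inner_diff_left inner_diff_right inner_commute[of v u] algebra_simps)
      \<comment> \<open>The lower bound at \<open>u\<close> reads
        \<open>a * (u \<bullet> u) \<le> u \<bullet> v\<close>, because
        \<open>A *v u = v\<close>.\<close>
      also have "\<dots> \<le> v \<bullet> v - 2 * a * (u \<bullet> v) + a * (u \<bullet> v)"
        using lo[of u] \<open>0 < a\<close> by (simp add: v)
      finally show ?thesis
        using \<open>0 < a\<close> by (simp add: field_simps)
    qed
    ultimately show ?thesis
      by (simp add: u_def inner_commute)
  qed
  then show ?thesis
    by (auto simp: between_scaled_identities_iff inv_sym)
qed

section \<open>The L-BFGS recursion: one update, its iteration, the initial scaling\<close>

lemma outer_mult_vector: "outer u v *v w = (v \<bullet> w) *\<^sub>R (u :: real ^ 'k::finite)"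
  by (simp add: outer_def vec_eq_iff matrix_vector_mult_def inner_vec_def sum_distrib_left
      sum_distrib_right mult_ac)

lemma transpose_outer: "transpose (outer u v) = outer v u"
  by (simp add: outer_def transpose_def vec_eq_iff mult.commute)

lemma transpose_bfgs_update:
  fixes H :: "real ^ 'k::finite ^ 'k"
  assumes "transpose H = H"
  shows "transpose (bfgs_update H p) = bfgs_update H p"
  by (simp add: bfgs_update_def Let_def split_beta transpose_add transpose_diff transpose_scalar
      transpose_mat transpose_outer matrix_transpose_mul matrix_mul_assoc assms)

text \<open>The right factor of the update sends \<open>v\<close> to \<open>w\<close> and the left
  factor is its transpose, so \<open>H\<close> is met only at \<open>w\<close>; the rank-one term
  adds the square. Stating \<rho> and \<open>w\<close> by equations lets local definitions be
  plugged in directly.\<close>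

lemma inner_bfgs_update:
  fixes H :: "real ^ 'k::finite ^ 'k"
  assumes "\<rho> = inverse (s \<bullet> y)" "w = v - (\<rho> * (s \<bullet> v)) *\<^sub>R y"
  shows "v \<bullet> (bfgs_update H (s, y) *v v) = w \<bullet> (H *v w) + \<rho> * (s \<bullet> v)\<^sup>2"
proof -
  have w: "(mat 1 - \<rho> *\<^sub>R outer y s) *v v = w"
    by (simp add: assms(2) matrix_vector_mult_diff_rdistrib scaleR_matrix_vector_assoc[symmetric]
        outer_mult_vector)
  have "bfgs_update H (s, y) *v v = (mat 1 - \<rho> *\<^sub>R outer s y) *v (H *v w) + (\<rho> * (s \<bullet> v)) *\<^sub>R s"
    by (simp add: bfgs_update_def Let_def assms(1)[symmetric] matrix_vector_mult_add_rdistrib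
        matrix_vector_mul_assoc[symmetric] w scaleR_matrix_vector_assoc[symmetric] outer_mult_vector)
  also have "\<dots> = H *v w - (\<rho> * (y \<bullet> (H *v w))) *\<^sub>R s + (\<rho> * (s \<bullet> v)) *\<^sub>R s"
    by (simp add: matrix_vector_mult_diff_rdistrib scaleR_matrix_vector_assoc[symmetric]
        outer_mult_vector)
  finally have "v \<bullet> (bfgs_update H (s, y) *v v) =
      v \<bullet> (H *v w) - \<rho> * (y \<bullet> (H *v w)) * (s \<bullet> v) + \<rho> * (s \<bullet> v) * (s \<bullet> v)"
    by (simp add: inner_diff_right inner_add_right inner_commute[of v s])
  moreover have "w \<bullet> (H *v w) = v \<bullet> (H *v w) - \<rho> * (s \<bullet> v) * (y \<bullet> (H *v w))"
    by (simp add: assms(2) inner_diff_left)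
  ultimately show ?thesis
    by (simp add: power2_eq_square)
qed

text \<open>The condition on a single pair, split off from the bound on the memory length so that it
  passes to the tail of a list in the induction.\<close>

definition curvature_pair :: "real \<Rightarrow> real \<Rightarrow> (real ^ 'k::finite) \<times> (real ^ 'k) \<Rightarrow> bool" where
  "curvature_pair m M p \<longleftrightarrow>
     (case p of (s, y) \<Rightarrow> s \<noteq> 0 \<and> m < (s \<bullet> y) / (norm s)\<^sup>2 \<and> (norm y)\<^sup>2 / (s \<bullet> y) < M)"

text \<open>The parallelogram law with the difference term dropped.\<close>

lemma norm_add_squared_le: "(norm (x + y))\<^sup>2 \<le> 2 * (norm x)\<^sup>2 + 2 * (norm (y :: 'a::real_inner))\<^sup>2"
proof -
  have "(norm (x + y))\<^sup>2 + (norm (x - y))\<^sup>2 = 2 * (norm x)\<^sup>2 + 2 * (norm y)\<^sup>2"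
    by (simp add: power2_norm_eq_inner inner_add_left inner_add_right inner_diff_left
        inner_diff_right)
  then show ?thesis
    using zero_le_power2[of "norm (x - y)"] by linarith
qed

text \<open>\<open>v\<close> and \<open>w\<close> differ by a vector of squared length at most
  \<open>M * r\<close>, where \<open>r\<close> is the rank-one contribution \<rho> (s . v)^2. For
  the upper bound \<open>r\<close> is estimated by \<open>v\<close>. For the lower bound it is kept,
  being itself a summand of the new form.\<close>

lemma between_scaled_identities_bfgs_update:
  assumes H: "between_scaled_identities a b H" and "0 < a" "0 < b" "0 < m" "0 < M"
    and p: "curvature_pair m M p"
  shows "between_scaled_identities (1 / (2 / a + 2 * M)) (2 * b * (1 + M / m) + 1 / m) (bfgs_update H p)"
  unfolding between_scaled_identities_iff
proof (intro conjI allI)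
  show "transpose (bfgs_update H p) = bfgs_update H p"
    using H by (intro transpose_bfgs_update) (simp add: between_scaled_identities_iff)
  fix v
  obtain s y where sy: "p = (s, y)"
    by (cases p)
  define \<rho> where "\<rho> = inverse (s \<bullet> y)"
  define w where "w = v - (\<rho> * (s \<bullet> v)) *\<^sub>R y"
  define r where "r = \<rho> * (s \<bullet> v)\<^sup>2"
  have s: "0 < (norm s)\<^sup>2" and ms: "m < (s \<bullet> y) / (norm s)\<^sup>2" and My: "(norm y)\<^sup>2 / (s \<bullet> y) < M"
    using p by (auto simp: curvature_pair_def sy)
  \<comment> \<open>Positive curvature makes \<rho> positive, and the two curvature conditions
    become upper bounds on \<rho> |y|^2 and \<rho> |s|^2.\<close>
  have msy: "m * (norm s)\<^sup>2 < s \<bullet> y"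
    using s ms by (simp add: field_simps)
  then have sy_pos: "0 < s \<bullet> y"
    using s \<open>0 < m\<close> by (smt (verit) mult_pos_pos)
  then have \<rho>: "0 < \<rho>" and \<rho>y: "\<rho> * (norm y)\<^sup>2 \<le> M"
    using My by (simp_all add: \<rho>_def field_simps)
  have \<rho>s: "\<rho> * (norm s)\<^sup>2 \<le> 1 / m"
    using msy sy_pos \<open>0 < m\<close> by (simp add: \<rho>_def field_simps)
  have r: "0 \<le> r"
    using \<rho> by (simp add: r_def)
  have "(s \<bullet> v)\<^sup>2 \<le> (norm s)\<^sup>2 * (norm v)\<^sup>2"
    using Cauchy_Schwarz_ineq[of s v] by (simp add: power2_norm_eq_inner)
  then have "r \<le> (\<rho> * (norm s)\<^sup>2) * (norm v)\<^sup>2"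
    using \<rho> by (simp add: r_def mult.assoc)
  also have "\<dots> \<le> 1 / m * (norm v)\<^sup>2"
    using \<rho>s by (intro mult_right_mono) auto
  finally have r_le: "r \<le> 1 / m * (norm v)\<^sup>2" .
  \<comment> \<open>Of the two factors \<rho> in the square, one joins |y|^2 and is absorbed in
    \<open>M\<close>; the other completes \<open>r\<close>.\<close>
  have "(norm ((\<rho> * (s \<bullet> v)) *\<^sub>R y))\<^sup>2 = (\<rho> * (norm y)\<^sup>2) * r"
    by (simp add: r_def power_mult_distrib power2_eq_square algebra_simps)
  also have "\<dots> \<le> M * r"
    using \<rho>y r by (intro mult_right_mono)
  finally have shift: "(norm ((\<rho> * (s \<bullet> v)) *\<^sub>R y))\<^sup>2 \<le> M * r" .
  have "(norm w)\<^sup>2 \<le> 2 * (norm v)\<^sup>2 + 2 * (M * r)"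
    using norm_add_squared_le[of v "- ((\<rho> * (s \<bullet> v)) *\<^sub>R y)"] shift by (simp add: w_def)
  also have "\<dots> \<le> 2 * (norm v)\<^sup>2 + 2 * (M * (1 / m * (norm v)\<^sup>2))"
    using r_le \<open>0 < M\<close> by (intro add_left_mono mult_left_mono) auto
  finally have w_le: "(norm w)\<^sup>2 \<le> 2 * (1 + M / m) * (norm v)\<^sup>2"
    by (simp add: algebra_simps)
  have v_le: "(norm v)\<^sup>2 \<le> 2 * (norm w)\<^sup>2 + 2 * (M * r)"
    using norm_add_squared_le[of w "(\<rho> * (s \<bullet> v)) *\<^sub>R y"] shift by (simp add: w_def)
  have quad: "v \<bullet> (bfgs_update H p *v v) = w \<bullet> (H *v w) + r"
    unfolding sy r_def by (rule inner_bfgs_update[OF \<rho>_def w_def])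
  have Hw: "a * (norm w)\<^sup>2 \<le> w \<bullet> (H *v w)" "w \<bullet> (H *v w) \<le> b * (norm w)\<^sup>2"
    using H by (auto simp: between_scaled_identities_iff power2_norm_eq_inner)
  have "w \<bullet> (H *v w) \<le> b * (2 * (1 + M / m) * (norm v)\<^sup>2)"
    using Hw(2) mult_left_mono[OF w_le, of b] \<open>0 < b\<close> by linarith
  then show "v \<bullet> (bfgs_update H p *v v) \<le> (2 * b * (1 + M / m) + 1 / m) * (v \<bullet> v)"
    using r_le by (simp add: quad power2_norm_eq_inner algebra_simps)
  define h where "h = w \<bullet> (H *v w)"
  have h: "0 \<le> h"
    using Hw(1) \<open>0 < a\<close> by (smt (verit) h_def mult_nonneg_nonneg zero_le_power2)
  have "(norm w)\<^sup>2 \<le> h / a"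
    using Hw(1) \<open>0 < a\<close> by (simp add: h_def field_simps)
  then have "(norm v)\<^sup>2 \<le> 2 / a * h + 2 * M * r"
    using v_le by simp
  \<comment> \<open>Both coefficients are enlarged to their sum, so that the new form
    \<open>h + r\<close> factors out.\<close>
  also have "\<dots> \<le> (2 / a + 2 * M) * h + (2 / a + 2 * M) * r"
    using h r \<open>0 < a\<close> \<open>0 < M\<close> by (intro add_mono mult_right_mono) auto
  finally have "(norm v)\<^sup>2 \<le> (2 / a + 2 * M) * (h + r)"
    by (simp add: distrib_left)
  moreover have "0 < 2 / a + 2 * M"
    using \<open>0 < a\<close> \<open>0 < M\<close> by (simp add: add_pos_pos)
  ultimately show "1 / (2 / a + 2 * M) * (v \<bullet> v) \<le> v \<bullet> (bfgs_update H p *v v)"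
    by (simp add: quad h_def power2_norm_eq_inner pos_divide_le_eq mult.commute)
qed

text \<open>The constants are chosen before \<open>H\<close> and \<open>ps\<close>, which is what
  uniformity requires. Induction on the length bound, with \<open>a\<close> and \<open>b\<close>
  generalized: \<open>foldl\<close> applies the first pair first, and the remaining pairs start from
  the weakened constants.\<close>

lemma foldl_bfgs_update_bounds:
  fixes a b m M :: real
  assumes "0 < m" "0 < M" "0 < a" "0 < b"
  shows "\<exists>lo hi. 0 < lo \<and> 0 < hi \<and>
    (\<forall>(H :: real ^ 'k::finite ^ 'k) ps. between_scaled_identities a b H \<longrightarrow> length ps \<le> n \<longrightarrow>
       (\<forall>p\<in>set ps. curvature_pair m M p) \<longrightarrow>
       between_scaled_identities lo hi (foldl bfgs_update H ps))"
  using \<open>0 < a\<close> \<open>0 < b\<close>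
proof (induction n arbitrary: a b)
  case 0
  then show ?case
    by (intro exI[of _ a] exI[of _ b]) auto
next
  case (Suc n)
  define a' where "a' = 1 / (2 / a + 2 * M)"
  define b' where "b' = 2 * b * (1 + M / m) + 1 / m"
  \<comment> \<open>The new interval contains the old one. This covers lists shorter than the length
    bound: for the empty list \<open>H\<close> itself satisfies the weaker bounds.\<close>
  have "0 < a'" "a' \<le> a" "0 < b'" "b \<le> b'"
  proof -
    have "0 < 1 / a" "1 / a \<le> 2 / a"
      using Suc.prems by (auto simp: divide_right_mono)
    then have "1 / a \<le> 2 / a + 2 * M" "0 < 2 / a + 2 * M"
      using \<open>0 < M\<close> by linarith+
    then show "0 < a'" "a' \<le> a"
      using Suc.prems le_imp_inverse_le[OF \<open>1 / a \<le> 2 / a + 2 * M\<close> \<open>0 < 1 / a\<close>]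
      by (simp_all add: a'_def inverse_eq_divide)
    have "0 \<le> 2 * b * (M / m)" "0 < 1 / m"
      using Suc.prems assms by auto
    then show "0 < b'" "b \<le> b'"
      unfolding b'_def distrib_left using Suc.prems by linarith+
  qed
  then obtain lo hi where "0 < lo" "0 < hi" and
    IH: "\<And>(H :: real ^ 'k ^ 'k) ps. between_scaled_identities a' b' H \<Longrightarrow> length ps \<le> n \<Longrightarrow>
       \<forall>p\<in>set ps. curvature_pair m M p \<Longrightarrow> between_scaled_identities lo hi (foldl bfgs_update H ps)"
    using Suc.IH[of a' b'] by blast
  have "between_scaled_identities lo hi (foldl bfgs_update H ps)"
    if H: "between_scaled_identities a b H" and ps: "length ps \<le> Suc n" "\<forall>p\<in>set ps. curvature_pair m M p"
    for H :: "real ^ 'k ^ 'k" and ps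
  proof (cases ps)
    case Nil
    then show ?thesis
      using IH[of H ps] between_scaled_identities_mono[OF H \<open>a' \<le> a\<close> \<open>b \<le> b'\<close>] by simp
  next
    case (Cons p qs)
    have "between_scaled_identities a' b' (bfgs_update H p)"
      unfolding a'_def b'_def using H Suc.prems assms(1,2) ps
      by (intro between_scaled_identities_bfgs_update) (auto simp: Cons)
    then show ?thesis
      using IH[of "bfgs_update H p" qs] ps by (simp add: Cons)
  qed
  with \<open>0 < lo\<close> \<open>0 < hi\<close> show ?case
    by blast
qed

text \<open>Clamping confines the quotient whatever \<open>P\<close> and the last pair are; the
  minimum and maximum with \<chi>0 account for the empty memory.\<close>

lemma chi_scale_bounds:
  assumes "\<chi>min \<le> \<chi>max"
  shows "min \<chi>0 \<chi>min \<le> chi_scale \<chi>0 \<chi>min \<chi>max mem P" "chi_scale \<chi>0 \<chi>min \<chi>max mem P \<le> max \<chi>0 \<chi>max"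
  using assms by (auto simp: chi_scale_def Let_def split_beta)

section \<open>Bounds on the preconditioner\<close>

lemma Jmat_mult_vector: "(Jmat f z *v v) $ i = qvec (f i) (xpart z) \<bullet> v"
  by (simp add: Jmat_def matrix_vector_mul_component)

lemma Dhyp_mult_vector: "(Dhyp f \<tau> z *v u) $ i = inverse (omega (f i) \<tau> z) * u $ i"
proof -
  \<comment> \<open>With the case distinction outermost, the sum collapses to its single diagonal
    term.\<close>
  have "(Dhyp f \<tau> z *v u) $ i = (\<Sum>k\<in>UNIV. if i = k then inverse (omega (f i) \<tau> z) * u $ k else 0)"
    unfolding matrix_vector_mult_def Dhyp_def vec_lambda_beta by (rule sum.cong) auto
  then show ?thesis
    by simp
qed

lemma Pi_x_mult_vector: "(Pi_x *v v) $ k = (if k = None then 0 else v $ k)"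
proof -
  have "(Pi_x *v v) $ k = (\<Sum>l\<in>UNIV. if k = l then (if k = None then 0 else v $ l) else 0)"
    unfolding matrix_vector_mult_def Pi_x_def vec_lambda_beta by (rule sum.cong) auto
  then show ?thesis
    by simp
qed

lemma transpose_Pi_x: "transpose Pi_x = Pi_x"
  by (auto simp: Pi_x_def transpose_def vec_eq_iff)

lemma transpose_precond: "transpose (precond \<delta> c f \<tau> z) = precond \<delta> c f \<tau> z"
proof -
  have "transpose (Dhyp f \<tau> z) = Dhyp f \<tau> z"
    by (simp add: Dhyp_def transpose_def vec_eq_iff)
  then show ?thesis
    by (simp add: precond_def transpose_add transpose_scalar transpose_mat transpose_Pi_x
        matrix_transpose_mul matrix_mul_assoc)
qed

text \<open>The last term is the form of the diagonal matrix \<open>Dhyp\<close> at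
  \<open>Jmat f z *v v\<close>, hence a weighted sum of squares.\<close>

lemma inner_precond:
  "v \<bullet> (precond \<delta> c f \<tau> z *v v) = \<delta> * (v \<bullet> v) + c * (v \<bullet> (Pi_x *v v)) +
     1/2 * (\<Sum>i\<in>UNIV. inverse (omega (f i) \<tau> z) * (qvec (f i) (xpart z) \<bullet> v)\<^sup>2)"
proof -
  let ?u = "Jmat f z *v v"
  have "v \<bullet> ((transpose (Jmat f z) ** Dhyp f \<tau> z ** Jmat f z) *v v) = ?u \<bullet> (Dhyp f \<tau> z *v ?u)"
    by (metis dot_lmul_matrix inner_commute matrix_vector_mul_assoc transpose_matrix_vector)
  also have "\<dots> = (\<Sum>i\<in>UNIV. inverse (omega (f i) \<tau> z) * (qvec (f i) (xpart z) \<bullet> v)\<^sup>2)"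
    by (simp add: inner_vec_def[of ?u] Dhyp_mult_vector Jmat_mult_vector power2_eq_square mult_ac)
  finally show ?thesis
    by (simp add: precond_def matrix_vector_mult_add_rdistrib scaleR_matrix_vector_assoc[symmetric]
        inner_add_right)
qed

text \<open>All terms beyond the multiple of the identity are nonnegative, so \<delta> bounds from
  below. Above, \<open>Pi_x\<close> is a projection and Cauchy-Schwarz handles each square. The
  bounds depend on \<open>z\<close> only through \<open>Q\<close>.\<close>

lemma between_scaled_identities_precond:
  fixes f :: "'m::finite \<Rightarrow> real ^ 'n::finite \<Rightarrow> real"
  assumes "0 < \<tau>" "0 \<le> c" and Q: "\<And>i. norm (qvec (f i) (xpart z)) \<le> Q i"
  shows "between_scaled_identities \<delta> (\<delta> + c + 1/2 * (\<Sum>i\<in>UNIV. inverse \<tau> * (Q i)\<^sup>2)) (precond \<delta> c f \<tau> z)"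
  unfolding between_scaled_identities_iff
proof (intro conjI allI)
  fix v :: "real ^ 'n option"
  have "0 \<le> v \<bullet> (Pi_x *v v)"
    by (auto simp: inner_vec_def Pi_x_mult_vector intro!: sum_nonneg)
  moreover have "v \<bullet> (Pi_x *v v) \<le> v \<bullet> v"
    by (auto simp: inner_vec_def Pi_x_mult_vector intro!: sum_mono)
  ultimately have Pi: "0 \<le> c * (v \<bullet> (Pi_x *v v))" "c * (v \<bullet> (Pi_x *v v)) \<le> c * (v \<bullet> v)"
    using \<open>0 \<le> c\<close> by (auto intro: mult_left_mono)
  \<comment> \<open>This floor holds whatever the value of \<open>f i\<close>, so the weights need
    no estimate of \<open>f i\<close>.\<close>
  have omega: "\<tau> \<le> omega (f i) \<tau> z" for i
    unfolding omega_def using \<open>0 < \<tau>\<close> by (intro real_le_rsqrt) auto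
  have "0 \<le> inverse (omega (f i) \<tau> z) * (qvec (f i) (xpart z) \<bullet> v)\<^sup>2" for i
    using omega[of i] \<open>0 < \<tau>\<close> by simp
  then have "0 \<le> (\<Sum>i\<in>UNIV. inverse (omega (f i) \<tau> z) * (qvec (f i) (xpart z) \<bullet> v)\<^sup>2)"
    by (intro sum_nonneg)
  with Pi show "\<delta> * (v \<bullet> v) \<le> v \<bullet> (precond \<delta> c f \<tau> z *v v)"
    by (simp add: inner_precond)
  have "inverse (omega (f i) \<tau> z) * (qvec (f i) (xpart z) \<bullet> v)\<^sup>2 \<le> inverse \<tau> * ((Q i)\<^sup>2 * (v \<bullet> v))" for i
  proof (rule mult_mono)
    show "inverse (omega (f i) \<tau> z) \<le> inverse \<tau>"
      using omega \<open>0 < \<tau>\<close> by (rule le_imp_inverse_le)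
    have "(qvec (f i) (xpart z) \<bullet> v)\<^sup>2 \<le> (norm (qvec (f i) (xpart z)))\<^sup>2 * (v \<bullet> v)"
      using Cauchy_Schwarz_ineq[of "qvec (f i) (xpart z)" v] by (simp add: power2_norm_eq_inner)
    also have "\<dots> \<le> (Q i)\<^sup>2 * (v \<bullet> v)"
      using Q[of i] by (intro mult_right_mono power_mono) auto
    finally show "(qvec (f i) (xpart z) \<bullet> v)\<^sup>2 \<le> (Q i)\<^sup>2 * (v \<bullet> v)" .
  qed (use \<open>0 < \<tau>\<close> in auto)
  then have "(\<Sum>i\<in>UNIV. inverse (omega (f i) \<tau> z) * (qvec (f i) (xpart z) \<bullet> v)\<^sup>2) \<le>
      (\<Sum>i\<in>UNIV. inverse \<tau> * ((Q i)\<^sup>2 * (v \<bullet> v)))"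
    by (intro sum_mono)
  also have "\<dots> = (\<Sum>i\<in>UNIV. inverse \<tau> * (Q i)\<^sup>2) * (v \<bullet> v)"
    by (simp add: sum_distrib_right mult.assoc)
  finally show "v \<bullet> (precond \<delta> c f \<tau> z *v v) \<le>
      (\<delta> + c + 1/2 * (\<Sum>i\<in>UNIV. inverse \<tau> * (Q i)\<^sup>2)) * (v \<bullet> v)"
    using Pi by (simp add: inner_precond distrib_right)
qed (rule transpose_precond)

section \<open>Uniform constants over the compact set, and descent\<close>

lemma continuous_on_xpart: "continuous_on S xpart"
  unfolding xpart_def by (intro continuous_intros)

lemma continuous_on_qvec:
  assumes "continuous_on S (gradient f)"
  shows "continuous_on S (qvec f)"
  unfolding qvec_def
proof (rule continuous_on_vec_lambda)
  fix k
  show "continuous_on S (\<lambda>x. case k of Some j \<Rightarrow> gradient f x $ j | None \<Rightarrow> - 1)"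
    using assms by (cases k) (auto intro!: continuous_intros)
qed

theorem lemma6p1:
  fixes f :: "'m::finite \<Rightarrow> real ^ 'n::finite \<Rightarrow> real"
    and \<tau> \<delta> \<chi>0 \<chi>min \<chi>max mcur Mcur :: real
    and L :: "'m \<Rightarrow> real"
    and mL :: nat
    and K Z :: "(real ^ ('n option)) set"
    and trial :: "((real ^ ('n option)) \<times> (real ^ ('n option))) set"
    and X :: "(real ^ 'n) set"
  assumes f_diff: "\<And>i x. f i differentiable (at x)"
    and tau: "\<tau> > 0"
    and delta: "\<delta> > 0"
    and mL: "mL \<ge> 1"
    and cur: "0 < mcur" "mcur < Mcur"
    and chi: "\<chi>0 > 0" "0 < \<chi>min" "\<chi>min \<le> \<chi>max"
    and iterates_X: "xpart ` Z \<subseteq> X"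
    and trial_X: "\<And>a b. (a, b) \<in> trial \<Longrightarrow> xpart ` closed_segment a b \<subseteq> X"
    and L_nonneg: "\<And>i. L i \<ge> 0"
    and L_lipschitz: "\<And>i. (L i)-lipschitz_on X (gradient (f i))"
    and K_compact: "compact K"
    and iterates_K: "Z \<subseteq> K"
    and grad_cont: "\<And>i. continuous_on (xpart ` K) (gradient (f i))"
  shows "(\<exists>hlow hup. 0 < hlow \<and> hlow \<le> hup \<and>
           (\<forall>z\<in>K. \<forall>mem. admissible_memory mL mcur Mcur mem \<longrightarrow>
              (let H = lbfgs_metric \<chi>0 \<chi>min \<chi>max mem (precond \<delta> (\<Sum>i\<in>UNIV. L i) f \<tau> z)
               in hlow *\<^sub>R mat 1 \<preceq> H \<and> H \<preceq> hup *\<^sub>R mat 1)))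
       \<and> (\<forall>z\<in>K. \<forall>mem. admissible_memory mL mcur Mcur mem \<longrightarrow>
              (let H = lbfgs_metric \<chi>0 \<chi>min \<chi>max mem (precond \<delta> (\<Sum>i\<in>UNIV. L i) f \<tau> z);
                   g = gradient (Phi f \<tau>) z;
                   d = - (H *v g)
               in g \<noteq> 0 \<longrightarrow> g \<bullet> d < 0))"
proof -
  let ?H = "\<lambda>z mem. lbfgs_metric \<chi>0 \<chi>min \<chi>max mem (precond \<delta> (\<Sum>i\<in>UNIV. L i) f \<tau> z)"
  \<comment> \<open>Compactness enters here: the continuous image of \<open>K\<close> under
    \<open>xpart\<close> and then \<open>qvec (f i)\<close> is bounded.\<close>
  have "\<exists>Q. \<forall>z\<in>K. norm (qvec (f i) (xpart z)) \<le> Q" for i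
  proof -
    have "compact (qvec (f i) ` xpart ` K)"
      by (intro compact_continuous_image continuous_on_qvec continuous_on_xpart grad_cont K_compact)
    then have "bounded (qvec (f i) ` xpart ` K)"
      by (rule compact_imp_bounded)
    then show ?thesis
      unfolding bounded_iff by blast
  qed
  then have "\<exists>Q. \<forall>i. \<forall>z\<in>K. norm (qvec (f i) (xpart z)) \<le> Q i"
    by (intro choice allI)
  then obtain Q where Q: "\<And>i z. z \<in> K \<Longrightarrow> norm (qvec (f i) (xpart z)) \<le> Q i"
    by blast
  define P where "P = \<delta> + (\<Sum>i\<in>UNIV. L i) + 1/2 * (\<Sum>i\<in>UNIV. inverse \<tau> * (Q i)\<^sup>2)"
  have sum_L: "0 \<le> (\<Sum>i\<in>UNIV. L i)"
    by (intro sum_nonneg L_nonneg)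
  have "0 \<le> (\<Sum>i\<in>UNIV. inverse \<tau> * (Q i)\<^sup>2)"
    using tau by (intro sum_nonneg) simp
  then have "0 < P"
    using delta sum_L by (simp add: P_def)
  \<comment> \<open>The bounds on the initial metric: the range of \<open>chi_scale\<close> times
    the bounds \<open>1 / P\<close> and 1/\<delta> on the inverse preconditioner.\<close>
  define a where "a = min \<chi>0 \<chi>min * (1 / P)"
  define b where "b = max \<chi>0 \<chi>max * (1 / \<delta>)"
  have "0 < a" "0 < b"
    using chi delta \<open>0 < P\<close> by (auto simp: a_def b_def less_max_iff_disj intro!: divide_pos_pos)
  \<comment> \<open>\<open>lo\<close> and \<open>hi\<close> are fixed before any iterate or memory
    is, hence serve all of them.\<close>
  then obtain lo hi where "0 < lo" "0 < hi" and fold: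
    "\<And>(H :: real ^ 'n option ^ 'n option) ps. between_scaled_identities a b H \<Longrightarrow> length ps \<le> mL \<Longrightarrow>
       \<forall>p\<in>set ps. curvature_pair mcur Mcur p \<Longrightarrow> between_scaled_identities lo hi (foldl bfgs_update H ps)"
    using foldl_bfgs_update_bounds[OF cur(1) less_trans[OF cur], of a b mL] by blast
  have bounds: "between_scaled_identities lo hi (?H z mem)"
    if "z \<in> K" and mem: "admissible_memory mL mcur Mcur mem" for z mem
  proof -
    have "between_scaled_identities (1 / P) (1 / \<delta>) (matrix_inv (precond \<delta> (\<Sum>i\<in>UNIV. L i) f \<tau> z))"
      unfolding P_def
      by (rule between_scaled_identities_matrix_inv[OF between_scaled_identities_precond])
        (use tau sum_L Q[OF \<open>z \<in> K\<close>] delta \<open>0 < P\<close> in \<open>simp_all add: P_def\<close>)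
    then have "between_scaled_identities a b
        (chi_scale \<chi>0 \<chi>min \<chi>max mem (precond \<delta> (\<Sum>i\<in>UNIV. L i) f \<tau> z) *\<^sub>R
          matrix_inv (precond \<delta> (\<Sum>i\<in>UNIV. L i) f \<tau> z))"
      unfolding a_def b_def
      by (rule between_scaled_identities_scaleR)
        (use chi delta \<open>0 < P\<close> in \<open>simp_all add: chi_scale_bounds\<close>)
    moreover have "length mem \<le> mL" "\<forall>p\<in>set mem. curvature_pair mcur Mcur p"
      using mem by (auto simp: admissible_memory_def curvature_pair_def)
    ultimately show ?thesis
      unfolding lbfgs_metric_def by (rule fold)
  qed
  \<comment> \<open>Positive definiteness gives descent for every nonzero vector; the gradient of
    \<open>Phi f \<tau>\<close> is one instance.\<close>
  have descent: "g \<bullet> - (?H z mem *v g) < 0"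
    if "z \<in> K" "admissible_memory mL mcur Mcur mem" "g \<noteq> 0" for z mem g
  proof -
    have "lo * (g \<bullet> g) \<le> g \<bullet> (?H z mem *v g)"
      using bounds[OF that(1,2)] unfolding between_scaled_identities_iff by blast
    moreover have "0 < lo * (g \<bullet> g)"
      using \<open>0 < lo\<close> \<open>g \<noteq> 0\<close> by simp
    ultimately show ?thesis
      by simp
  qed
  \<comment> \<open>Taking the maximum supplies the required order of the two constants, of which
    only positivity is known so far.\<close>
  have "between_scaled_identities lo (max lo hi) (?H z mem)"
    if "z \<in> K" "admissible_memory mL mcur Mcur mem" for z mem
    using bounds[OF that] by (rule between_scaled_identities_mono) auto
  moreover have "lo \<le> max lo hi"
    by simp
  ultimately show ?thesis
    using \<open>0 < lo\<close> descent unfolding Let_def between_scaled_identities_def by blast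
qed

end
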